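(* Let $\sigma\ge1$, let $\varphi=(\varphi_1,\dots,\varphi_b)$ be a solid $b$-fold $k$-coloring of $G_{[1,\sigma]}$, let $\eta$ be a shading of $\varphi$, and let $(D_i)_{i\in[n]}$ be a sequence of disks with diameters in $[1,\sigma]$. Then algorithm FoldShadeColor with $\varphi,\eta$ on input $(D_i)_{i\in[n]}$ returns a proper coloring of $G=G((D_i)_{i\in[n]})$ whose largest color is at most $k\cdot\left\lfloor\frac{\omega(G)+(b-1)\gamma/2}{b}\right\rfloor$, where $\gamma$ is the maximum number of subtiles in one tile of $\varphi$.
   Context: $G_{[1,\sigma]}$ is the infinite graph on $\mathbb R^2$ with two points adjacent iff their distance lies in $[1,\sigma]$. A $b$-fold coloring of $G_{[1,\sigma]}$ with colors $[k]$ is a tuple $(\varphi_1,\dots,\varphi_b)$, $\varphi_r:\mathbb R^2\to[k]$, with $\varphi_r(p)\ne\varphi_s(p)$ for $r\ne s$ and $\varphi_r(p_1)\ne\varphi_s(p_2)$ for all $r,s$ whenever $\mathrm{dist}(p_1,p_2)\in[1,\sigma]$. It is solid if there are $b$ tilings of the plane into congruent tiles (the $r$-th tiling is the $r$-th layer) such that $\varphi_r$ is constant on each tile of the $r$-th tiling, any two points of one tile are at distance less than $1$, and distinct tiles of the same color (possibly from different layers) are at point-to-point distance greater than $\sigma$. A subtile is a non-empty intersection of $b$ tiles, one from each layer. A shading of $\varphi$ is a function $\eta$ assigning a number in $[b]$ to each subtile such that in every tile, for each value in $[b]$, the number of subtiles of that tile with that $\eta$-value is the same. For disks $(D_i)_{i\in[n]}$,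 $G((D_i))$ has one vertex $v_i$ per disk, identified with the center of $D_i$ (distinct disks give distinct vertices), with $v_iv_j$ an edge iff $D_i\cap D_j\ne\emptyset$; $\omega(G)$ is the clique number. Algorithm FoldShadeColor (online): when $D_i$ is read, for each $r\in[b]$ let $T_r(v_i)$ be the tile of layer $r$ containing $v_i$, let $S=\bigcap_{r}T_r(v_i)$ be the subtile containing $v_i$ and $m$ the number of earlier vertices $v_1,\dots,v_{i-1}$ in $S$; set $\ell(v_i)=1+\big((\eta(S)-1+m)\bmod b\big)$ (so vertices of $S$ are assigned to layers cyclically starting from layer $\eta(S)$); let $t(v_i)$ be the number of earlier vertices $u$ in $T_{\ell(v_i)}(v_i)$ with $\ell(u)=\ell(v_i)$; assign $c(v_i)=\varphi_{\ell(v_i)}(v_i)+k\,t(v_i)$. *)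

theory Defs
  imports "HOL-Analysis.Analysis" "HOL-Library.Disjoint_Sets" "HOL-Library.Ramsey"
begin

type_synonym plane = "real ^ 2"

text \<open>Layers, colors and vertices are all numbered from 1, so that \<open>[m]\<close> is \<open>{1..m}\<close>.\<close>

definition dist_graph_adj :: "real \<Rightarrow> plane \<Rightarrow> plane \<Rightarrow> bool" where
  "dist_graph_adj \<sigma> p q \<longleftrightarrow> dist p q \<in> {1..\<sigma>}"

definition fold_coloring :: "real \<Rightarrow> nat \<Rightarrow> nat \<Rightarrow> (nat \<Rightarrow> plane \<Rightarrow> nat) \<Rightarrow> bool" where
  "fold_coloring \<sigma> b k \<phi> \<longleftrightarrow>
     (\<forall>r\<in>{1..b}. \<forall>p. \<phi> r p \<in> {1..k}) \<and>
     (\<forall>r\<in>{1..b}. \<forall>s\<in>{1..b}. \<forall>p. r \<noteq> s \<longrightarrow> \<phi> r p \<noteq> \<phi> s p) \<and>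
     (\<forall>r\<in>{1..b}. \<forall>s\<in>{1..b}. \<forall>p q. dist_graph_adj \<sigma> p q \<longrightarrow> \<phi> r p \<noteq> \<phi> s q)"

definition congruent_sets :: "plane set \<Rightarrow> plane set \<Rightarrow> bool" where
  "congruent_sets A B \<longleftrightarrow>
     (\<exists>f. bij f \<and> (\<forall>x y. dist (f x) (f y) = dist x y) \<and> f ` A = B)"

text \<open>
  Tiles partition the plane exactly, boundaries included: two tiles of a layer with a common point
  would have the same color, although distinct tiles of the same color have to be far apart.
\<close>

definition tiling :: "plane set set \<Rightarrow> bool" where
  "tiling P \<longleftrightarrow> partition_on UNIV P \<and> (\<forall>A\<in>P. \<forall>B\<in>P. congruent_sets A B)"

text \<open>
  \<open>\<T> r\<close> is the set of tiles of layer \<open>r\<close>. A fold coloring \<open>\<phi>\<close> is solid iff such a \<open>\<T>\<close> exists;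
  \<open>\<T>\<close> is kept as a parameter because subtiles and shadings refer to it. In the last clause
  \<open>\<phi> r p\<close> and \<open>\<phi> s q\<close> are the colors of the tiles \<open>A\<close> and \<open>B\<close>.
\<close>

definition solid_tilings ::
    "real \<Rightarrow> nat \<Rightarrow> (nat \<Rightarrow> plane \<Rightarrow> nat) \<Rightarrow> (nat \<Rightarrow> plane set set) \<Rightarrow> bool" where
  "solid_tilings \<sigma> b \<phi> \<T> \<longleftrightarrow>
     (\<forall>r\<in>{1..b}. tiling (\<T> r)) \<and>
     (\<forall>r\<in>{1..b}. \<forall>A\<in>\<T> r. \<forall>p\<in>A. \<forall>q\<in>A. \<phi> r p = \<phi> r q) \<and>
     (\<forall>r\<in>{1..b}. \<forall>A\<in>\<T> r. \<forall>p\<in>A. \<forall>q\<in>A. dist p q < 1) \<and>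
     (\<forall>r\<in>{1..b}. \<forall>s\<in>{1..b}. \<forall>A\<in>\<T> r. \<forall>B\<in>\<T> s. A \<noteq> B \<longrightarrow>
        (\<forall>p\<in>A. \<forall>q\<in>B. \<phi> r p = \<phi> s q \<longrightarrow> dist p q > \<sigma>))"

definition subtiles :: "nat \<Rightarrow> (nat \<Rightarrow> plane set set) \<Rightarrow> plane set set" where
  "subtiles b \<T> =
     {S. S \<noteq> {} \<and> (\<exists>A. (\<forall>r\<in>{1..b}. A r \<in> \<T> r) \<and> S = (\<Inter>r\<in>{1..b}. A r))}"

definition subtiles_of :: "nat \<Rightarrow> (nat \<Rightarrow> plane set set) \<Rightarrow> plane set \<Rightarrow> plane set set" where
  "subtiles_of b \<T> A = {S \<in> subtiles b \<T>. S \<subseteq> A}"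

definition max_subtiles :: "nat \<Rightarrow> (nat \<Rightarrow> plane set set) \<Rightarrow> nat" where
  "max_subtiles b \<T> = Max {card (subtiles_of b \<T> A) | r A. r \<in> {1..b} \<and> A \<in> \<T> r}"

definition shading :: "nat \<Rightarrow> (nat \<Rightarrow> plane set set) \<Rightarrow> (plane set \<Rightarrow> nat) \<Rightarrow> bool" where
  "shading b \<T> \<eta> \<longleftrightarrow>
     (\<forall>S\<in>subtiles b \<T>. \<eta> S \<in> {1..b}) \<and>
     (\<forall>r\<in>{1..b}. \<forall>A\<in>\<T> r. \<forall>i\<in>{1..b}. \<forall>j\<in>{1..b}.
        card {S \<in> subtiles_of b \<T> A. \<eta> S = i} = card {S \<in> subtiles_of b \<T> A. \<eta> S = j})"

text \<open>
  The vertices of the intersection graph are the indices \<open>1..n\<close>, so disks with the same center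
  still give distinct vertices. Edges are two-element sets, as in \<^const>\<open>clique\<close>.
\<close>

definition disk_graph_edges :: "nat \<Rightarrow> (nat \<Rightarrow> plane set) \<Rightarrow> nat set set" where
  "disk_graph_edges n D =
     {{i, j} | i j. i \<in> {1..n} \<and> j \<in> {1..n} \<and> i \<noteq> j \<and> D i \<inter> D j \<noteq> {}}"

definition clique_number :: "'a set \<Rightarrow> 'a set set \<Rightarrow> nat" where
  "clique_number V E = Max {card C | C. C \<subseteq> V \<and> clique C E}"

definition proper_coloring :: "'a set set \<Rightarrow> ('a \<Rightarrow> nat) \<Rightarrow> bool" where
  "proper_coloring E c \<longleftrightarrow> (\<forall>u w. {u, w} \<in> E \<longrightarrow> c u \<noteq> c w)"

definition tile_at :: "(nat \<Rightarrow> plane set set) \<Rightarrow> nat \<Rightarrow> plane \<Rightarrow> plane set" where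
  "tile_at \<T> r p = (THE A. A \<in> \<T> r \<and> p \<in> A)"

definition subtile_at :: "nat \<Rightarrow> (nat \<Rightarrow> plane set set) \<Rightarrow> plane \<Rightarrow> plane set" where
  "subtile_at b \<T> p = (\<Inter>r\<in>{1..b}. tile_at \<T> r p)"

text \<open>
  The online algorithm on the centers \<open>v 1, v 2, \<dots>\<close>: \<open>fsc_layer\<close>, \<open>fsc_round\<close> and
  \<open>fold_shade_color\<close> give \<open>\<ell>(v\<^sub>i)\<close>, \<open>t(v\<^sub>i)\<close> and \<open>c(v\<^sub>i)\<close>. Each depends only on \<open>v 1, \<dots>, v i\<close>.
\<close>

definition fsc_layer ::
    "nat \<Rightarrow> (nat \<Rightarrow> plane set set) \<Rightarrow> (plane set \<Rightarrow> nat) \<Rightarrow> (nat \<Rightarrow> plane) \<Rightarrow> nat \<Rightarrow> nat" where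
  "fsc_layer b \<T> \<eta> v i =
     (let S = subtile_at b \<T> (v i);
          m = card {j \<in> {1..<i}. v j \<in> S}
      in 1 + (\<eta> S - 1 + m) mod b)"

definition fsc_round ::
    "nat \<Rightarrow> (nat \<Rightarrow> plane set set) \<Rightarrow> (plane set \<Rightarrow> nat) \<Rightarrow> (nat \<Rightarrow> plane) \<Rightarrow> nat \<Rightarrow> nat" where
  "fsc_round b \<T> \<eta> v i =
     (let l = fsc_layer b \<T> \<eta> v i
      in card {j \<in> {1..<i}. v j \<in> tile_at \<T> l (v i) \<and> fsc_layer b \<T> \<eta> v j = l})"

definition fold_shade_color ::
    "nat \<Rightarrow> nat \<Rightarrow> (nat \<Rightarrow> plane \<Rightarrow> nat) \<Rightarrow> (nat \<Rightarrow> plane set set) \<Rightarrow> (plane set \<Rightarrow> nat)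
      \<Rightarrow> (nat \<Rightarrow> plane) \<Rightarrow> nat \<Rightarrow> nat" where
  "fold_shade_color b k \<phi> \<T> \<eta> v i =
     \<phi> (fsc_layer b \<T> \<eta> v i) (v i) + k * fsc_round b \<T> \<eta> v i"

end

theory Submission
  imports Defs
begin

text \<open>
  All vertices in one tile form a clique, because a tile has diameter less than 1 and every radius
  is at least 1/2. Cyclic assignment starting at \<open>\<eta> S\<close> sends to layer \<open>l\<close> at most
  \<open>(n\<^sub>S + w) / b\<close> of the \<open>n\<^sub>S\<close> vertices of a subtile \<open>S\<close>, where \<open>w \<in> {0..b-1}\<close> is congruent to
  \<open>\<eta> S - l - 1\<close> modulo \<open>b\<close>. The shading makes \<open>w\<close> equidistributed over the subtiles of a tile, so
  its average is \<open>(b-1)/2\<close>, and summing over the subtiles of the tile gives the bound.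
\<close>

section \<open>Counting residues and averaging over them\<close>

lemma card_cyclic_le:
  fixes b e r N :: nat
  assumes "r < b"
  shows "b * card {m \<in> {..<N}. (e + m) mod b = r} \<le> N + (e + (b - 1 - r)) mod b"
proof -
  \<comment> \<open>This offset is congruent to \<open>e - r - 1\<close> modulo \<open>b\<close>, so
    \<open>(e + m) mod b = r\<close> makes \<open>m + w + 1\<close> a multiple of \<open>b\<close>.
    Hence each solution below \<open>N\<close> comes from a positive multiple of \<open>b\<close>
    that is at most \<open>N + w\<close>.\<close>
  define w where "w = (e + (b - 1 - r)) mod b"
  have "{m \<in> {..<N}. (e + m) mod b = r} \<subseteq> (\<lambda>q. b * q - (w + 1)) ` {1..(N + w) div b}"
  proof
    fix m assume m: "m \<in> {m \<in> {..<N}. (e + m) mod b = r}"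
    have "(m + w) mod b = ((e + m) + (b - 1 - r)) mod b"
      unfolding w_def by (simp add: mod_simps algebra_simps)
    also have "\<dots> = ((e + m) mod b + (b - 1 - r)) mod b"
      by (simp add: mod_simps)
    also have "\<dots> = b - 1"
      using m assms by simp
    finally have "(m + w + 1) mod b = (b - 1 + 1) mod b"
      by (metis mod_add_left_eq)
    then have "b dvd m + w + 1"
      using assms by auto
    then obtain q where q: "m + w + 1 = b * q" ..
    have "q * b \<le> N + w"
      using m q by (simp add: mult.commute)
    then have "q \<le> (N + w) div b"
      using assms by (simp add: less_eq_div_iff_mult_less_eq)
    moreover have "q \<ge> 1"
      using q by (cases q) auto
    ultimately show "m \<in> (\<lambda>q. b * q - (w + 1)) ` {1..(N + w) div b}"
      using q by (intro image_eqI[of _ _ q]) auto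
  qed
  then have "card {m \<in> {..<N}. (e + m) mod b = r} \<le> card {1..(N + w) div b}"
    by (rule surj_card_le[rotated]) simp
  then have "b * card {m \<in> {..<N}. (e + m) mod b = r} \<le> b * ((N + w) div b)"
    by simp
  also have "\<dots> \<le> N + w"
    by simp
  finally show ?thesis
    unfolding w_def .
qed

text \<open>As \<open>e\<close> runs over \<open>{1..b}\<close>, \<open>e - 1\<close> meets every
  residue once, and adding \<open>a\<close> only permutes the residues. The sum is therefore 0 + 1 +
  ... + (b - 1); the factor 2 avoids division in \<open>nat\<close>.\<close>

lemma sum_rotation:
  fixes b a :: nat
  assumes "b \<ge> 1"
  shows "2 * (\<Sum>e\<in>{1..b}. (e - 1 + a) mod b) = b * (b - 1)"
proof -
  \<comment> \<open>One inequality at a time, because subtraction is truncated: if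
    \<open>y < x\<close>, then \<open>x - y\<close> would be a positive multiple of \<open>b\<close>
    smaller than \<open>b\<close>. Exchanging \<open>x\<close> and \<open>y\<close> gives
    equality.\<close>
  have "x \<le> y" if "(x + a) mod b = (y + a) mod b" "x < b" for x y
  proof (rule ccontr)
    assume "\<not> x \<le> y"
    then have "b dvd x - y"
      using that mod_eq_dvd_iff_nat[of "y + a" "x + a" b] by simp
    then show False
      using \<open>\<not> x \<le> y\<close> that(2) by (auto dest: dvd_imp_le)
  qed
  then have shift: "x = y" if "(x + a) mod b = (y + a) mod b" "x < b" "y < b" for x y
    using that by (metis order_antisym)
  have inj: "inj_on (\<lambda>e. (e - 1 + a) mod b) {1..b}"
  proof (rule inj_onI)
    fix x y assume "x \<in> {1..b}" "y \<in> {1..b}" "(x - 1 + a) mod b = (y - 1 + a) mod b"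
    moreover from this have "x - 1 = y - 1"
      by (intro shift[of "x - 1" "y - 1"]) auto
    ultimately show "x = y"
      by auto
  qed
  have "(\<lambda>e. (e - 1 + a) mod b) ` {1..b} = {..<b}"
  proof (rule card_subset_eq)
    show "card ((\<lambda>e. (e - 1 + a) mod b) ` {1..b}) = card {..<b}"
      using card_image[OF inj] by simp
  qed (use assms in auto)
  then have "(\<Sum>e\<in>{1..b}. (e - 1 + a) mod b) = \<Sum>{..<b}"
    using sum.reindex[OF inj, of id] by simp
  also have "2 * \<dots> = b * (b - 1)"
    by (induction b) (auto simp: algebra_simps)
  finally show ?thesis by simp
qed

text \<open>All fibers of \<open>\<eta>\<close> over \<open>{1..b}\<close> have the same size, so
  averaging \<open>g (\<eta> S)\<close> over \<open>F\<close> is the same as averaging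
  \<open>g\<close> over \<open>{1..b}\<close>. The equation is that statement with denominators
  cleared.\<close>

lemma sum_equidistributed:
  fixes g :: "nat \<Rightarrow> nat"
  assumes "finite F" and "\<And>S. S \<in> F \<Longrightarrow> \<eta> S \<in> {1..b::nat}"
    and "\<And>i j. i \<in> {1..b} \<Longrightarrow> j \<in> {1..b} \<Longrightarrow> card {S \<in> F. \<eta> S = i} = card {S \<in> F. \<eta> S = j}"
  shows "b * (\<Sum>S\<in>F. g (\<eta> S)) = card F * (\<Sum>i\<in>{1..b}. g i)"
proof (cases "b = 0")
  case False
  define c where "c = card {S \<in> F. \<eta> S = 1}"
  have c: "card {S \<in> F. \<eta> S = i} = c" if "i \<in> {1..b}" for i
    using assms(3)[of i 1] that False unfolding c_def by auto
  \<comment> \<open>The weight \<open>h\<close> is arbitrary because the constant 1 is needed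
    besides \<open>g\<close>: it yields \<open>card F = c * b\<close>, which eliminates
    \<open>c\<close>.\<close>
  have group: "(\<Sum>S\<in>F. h (\<eta> S)) = c * (\<Sum>i\<in>{1..b}. h i)" for h :: "nat \<Rightarrow> nat"
  proof -
    have "(\<Sum>S\<in>F. h (\<eta> S)) = (\<Sum>i\<in>{1..b}. \<Sum>S\<in>{S \<in> F. \<eta> S = i}. h (\<eta> S))"
      using assms by (intro sum.group[symmetric]) auto
    also have "\<dots> = (\<Sum>i\<in>{1..b}. c * h i)"
      by (intro sum.cong) (auto simp: c)
    finally show ?thesis
      by (simp add: sum_distrib_left)
  qed
  show ?thesis
    using group[of g] group[of "\<lambda>_. 1"] by (simp add: algebra_simps)
qed (use assms in auto)

section \<open>Tiles and subtiles of a solid coloring\<close>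

locale solid_fold_coloring =
  fixes \<sigma> :: real and b k :: nat
    and \<phi> :: "nat \<Rightarrow> plane \<Rightarrow> nat" and \<T> :: "nat \<Rightarrow> plane set set"
  assumes sigma: "\<sigma> \<ge> 1" and b_pos: "b \<ge> 1"
    and coloring: "fold_coloring \<sigma> b k \<phi>"
    and solid: "solid_tilings \<sigma> b \<phi> \<T>"
begin

lemma tile_at_eq:
  assumes "r \<in> {1..b}" "A \<in> \<T> r" "p \<in> A"
  shows "tile_at \<T> r p = A"
  unfolding tile_at_def
proof (rule the_equality)
  have "disjoint (\<T> r)"
    using solid assms(1) unfolding solid_tilings_def tiling_def partition_on_def by simp
  then show "B = A" if "B \<in> \<T> r \<and> p \<in> B" for B
    using that assms(2,3) by (metis disjointD disjoint_iff)
qed (use assms in blast)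

lemma tile_at:
  assumes "r \<in> {1..b}"
  shows "tile_at \<T> r p \<in> \<T> r" "p \<in> tile_at \<T> r p"
proof -
  have "\<Union>(\<T> r) = UNIV"
    using solid assms unfolding solid_tilings_def tiling_def partition_on_def by simp
  then obtain A where "A \<in> \<T> r" "p \<in> A"
    by blast
  then show "tile_at \<T> r p \<in> \<T> r" "p \<in> tile_at \<T> r p"
    using tile_at_eq[OF assms] by auto
qed

lemma color_range: "r \<in> {1..b} \<Longrightarrow> \<phi> r p \<in> {1..k}"
  using coloring[unfolded fold_coloring_def, THEN conjunct1] by blast

lemma tile_color_eq: "r \<in> {1..b} \<Longrightarrow> A \<in> \<T> r \<Longrightarrow> p \<in> A \<Longrightarrow> q \<in> A \<Longrightarrow> \<phi> r p = \<phi> r q"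
  using solid[unfolded solid_tilings_def, THEN conjunct2, THEN conjunct1] by blast

lemma tile_dist_less: "r \<in> {1..b} \<Longrightarrow> A \<in> \<T> r \<Longrightarrow> p \<in> A \<Longrightarrow> q \<in> A \<Longrightarrow> dist p q < 1"
  using solid[unfolded solid_tilings_def, THEN conjunct2, THEN conjunct2, THEN conjunct1] by blast

text \<open>Solidity gives \<open>A = B\<close>, but this alone does not identify the layers, since
  two layers could contain the same set as a tile. Now \<open>p\<close> lies in \<open>B\<close>
  too, so layers \<open>r\<close> and \<open>s\<close> give \<open>p\<close> the same color, which a
  fold coloring allows only for \<open>r = s\<close>.\<close>

lemma same_color_tile_eq:
  assumes "r \<in> {1..b}" "s \<in> {1..b}" "A \<in> \<T> r" "B \<in> \<T> s" "p \<in> A" "q \<in> B"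
    and "\<phi> r p = \<phi> s q" "dist p q \<le> \<sigma>"
  shows "A = B" "r = s"
proof -
  show "A = B"
    using solid assms unfolding solid_tilings_def by (meson not_less)
  then have "\<phi> s q = \<phi> s p"
    using assms tile_color_eq by blast
  then show "r = s"
    using coloring assms unfolding fold_coloring_def by metis
qed

lemma subtile_at_subset: "r \<in> {1..b} \<Longrightarrow> A \<in> \<T> r \<Longrightarrow> p \<in> A \<Longrightarrow> subtile_at b \<T> p \<subseteq> A"
  using tile_at_eq[of r A p] by (auto simp: subtile_at_def)

lemma mem_subtile_at: "p \<in> subtile_at b \<T> p"
  using tile_at(2) by (auto simp: subtile_at_def)

lemma subtile_at_in_subtiles: "subtile_at b \<T> p \<in> subtiles b \<T>"
  unfolding subtiles_def
proof (intro CollectI conjI exI)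
  show "subtile_at b \<T> p \<noteq> {}"
    using mem_subtile_at[of p] by blast
  show "\<forall>r\<in>{1..b}. tile_at \<T> r p \<in> \<T> r"
    using tile_at(1) by blast
qed (rule subtile_at_def)

lemma subtile_at_eq:
  assumes "S \<in> subtiles b \<T>" "p \<in> S"
  shows "subtile_at b \<T> p = S"
proof -
  obtain A where A: "\<forall>r\<in>{1..b}. A r \<in> \<T> r" "S = (\<Inter>r\<in>{1..b}. A r)"
    using assms unfolding subtiles_def by blast
  then have "tile_at \<T> r p = A r" if "r \<in> {1..b}" for r
    using that assms(2) by (intro tile_at_eq) auto
  then show ?thesis
    unfolding subtile_at_def A(2) by simp
qed

lemma subtile_at_in_subtiles_of:
  "r \<in> {1..b} \<Longrightarrow> A \<in> \<T> r \<Longrightarrow> p \<in> A \<Longrightarrow> subtile_at b \<T> p \<in> subtiles_of b \<T> A"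
  by (simp add: subtiles_of_def subtile_at_in_subtiles subtile_at_subset)

text \<open>
  Tiles of one layer that meet a common tile have different colors, so a subtile of a given tile
  is determined by its color vector.
\<close>

lemma subtiles_of_finite_card:
  assumes "r \<in> {1..b}" "A \<in> \<T> r"
  shows "finite (subtiles_of b \<T> A)" "card (subtiles_of b \<T> A) \<le> k ^ b"
proof -
  define pt where "pt S = (SOME p. p \<in> S)" for S :: "plane set"
  define f where "f S = (\<lambda>s\<in>{1..b}. \<phi> s (pt S))" for S
  let ?P = "{1..b} \<rightarrow>\<^sub>E {1..k}"
  have pt: "pt S \<in> S" if "S \<in> subtiles_of b \<T> A" for S
    using that by (simp add: pt_def subtiles_of_def subtiles_def some_in_eq)
  have inj: "inj_on f (subtiles_of b \<T> A)"
  proof (rule inj_onI)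
    fix S S' assume S: "S \<in> subtiles_of b \<T> A" "S' \<in> subtiles_of b \<T> A" and eq: "f S = f S'"
    have "pt S \<in> A" "pt S' \<in> A"
      using pt[OF S(1)] pt[OF S(2)] S by (auto simp: subtiles_of_def)
    then have d: "dist (pt S) (pt S') \<le> \<sigma>"
      using tile_dist_less[OF assms, of "pt S" "pt S'"] sigma by linarith
    have "tile_at \<T> s (pt S) = tile_at \<T> s (pt S')" if s: "s \<in> {1..b}" for s
    proof (rule same_color_tile_eq(1)[OF s s])
      show "\<phi> s (pt S) = \<phi> s (pt S')"
        using fun_cong[OF eq, of s] s by (simp add: f_def)
    qed (use tile_at s d in auto)
    then have "subtile_at b \<T> (pt S) = subtile_at b \<T> (pt S')"
      unfolding subtile_at_def by simp
    then show "S = S'"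
      using subtile_at_eq[OF _ pt[OF S(1)]] subtile_at_eq[OF _ pt[OF S(2)]] S
      by (simp add: subtiles_of_def)
  qed
  have sub: "f ` subtiles_of b \<T> A \<subseteq> ?P"
    using color_range unfolding f_def by auto
  have fin: "finite ?P"
    by (intro finite_PiE) auto
  show "finite (subtiles_of b \<T> A)"
    using inj_on_finite[OF inj sub fin] .
  show "card (subtiles_of b \<T> A) \<le> k ^ b"
    using card_inj_on_le[OF inj sub fin] by (simp add: card_PiE)
qed

lemma card_subtiles_of_le_max:
  assumes "r \<in> {1..b}" "A \<in> \<T> r"
  shows "card (subtiles_of b \<T> A) \<le> max_subtiles b \<T>"
proof -
  let ?M = "{card (subtiles_of b \<T> A) | r A. r \<in> {1..b} \<and> A \<in> \<T> r}"
  \<comment> \<open>\<open>Max\<close> is informative only on a finite set. The tiles may be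
    infinitely many, but the bound \<open>k ^ b\<close> does not depend on the tile, so only
    finitely many counts occur.\<close>
  have "?M \<subseteq> {..k ^ b}"
    using subtiles_of_finite_card(2) by auto
  then have "finite ?M"
    using finite_subset by blast
  then show ?thesis
    unfolding max_subtiles_def using assms by (intro Max_ge) blast+
qed

section \<open>Number of vertices assigned to a layer\<close>

lemma fsc_layer_range: "fsc_layer b \<T> \<eta> v i \<in> {1..b}"
  using b_pos by (auto simp: fsc_layer_def Let_def Suc_le_eq)

text \<open>The arrival rank \<open>m j\<close> of a vertex within \<open>S\<close> starts at 0 and
  strictly increases, so it identifies the vertex. Layer \<open>l\<close> receives exactly the ranks
  with \<open>(\<eta> S - 1 + m j) mod b = l - 1\<close>, which reduces the claim to
  \<open>card_cyclic_le\<close>.\<close>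

lemma card_layer_in_subtile:
  assumes "S \<in> subtiles b \<T>" "l \<in> {1..b}"
  shows "b * card {j \<in> {1..n}. v j \<in> S \<and> fsc_layer b \<T> \<eta> v j = l}
    \<le> card {j \<in> {1..n}. v j \<in> S} + (\<eta> S - 1 + (b - l)) mod b"
proof -
  define m where "m j = card {j' \<in> {1..<j}. v j' \<in> S}" for j
  let ?N = "card {j \<in> {1..n}. v j \<in> S}"
  let ?L = "{j \<in> {1..n}. v j \<in> S \<and> fsc_layer b \<T> \<eta> v j = l}"
  let ?R = "{m \<in> {..<?N}. (\<eta> S - 1 + m) mod b = l - 1}"
  have m_less: "m i < m j" if "i < j" "v i \<in> S" "i \<ge> 1" for i j
    unfolding m_def using that by (intro psubset_card_mono) auto
  have "inj_on m ?L"
  proof (rule inj_onI)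
    fix x y assume "x \<in> ?L" "y \<in> ?L" "m x = m y"
    then show "x = y"
      using m_less[of x y] m_less[of y x] by (cases x y rule: linorder_cases) auto
  qed
  moreover have "m ` ?L \<subseteq> ?R"
  proof
    fix x assume "x \<in> m ` ?L"
    then obtain j where j: "j \<in> {1..n}" "v j \<in> S" "fsc_layer b \<T> \<eta> v j = l" "x = m j"
      by blast
    have "m j < ?N"
      unfolding m_def using j by (intro psubset_card_mono) auto
    moreover have "(\<eta> S - 1 + m j) mod b = l - 1"
      using j(3) subtile_at_eq[OF assms(1) j(2)] unfolding fsc_layer_def Let_def m_def by auto
    ultimately show "x \<in> ?R"
      using j by simp
  qed
  ultimately have "card ?L \<le> card ?R"
    by (intro card_inj_on_le) auto
  then have "b * card ?L \<le> b * card ?R"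
    by simp
  also have "\<dots> \<le> ?N + (\<eta> S - 1 + (b - 1 - (l - 1))) mod b"
    using assms(2) by (intro card_cyclic_le) auto
  also have "b - 1 - (l - 1) = b - l"
    using assms(2) by auto
  finally show ?thesis .
qed

lemma card_layer_in_tile:
  assumes shading: "shading b \<T> \<eta>" and l: "l \<in> {1..b}" and A: "A \<in> \<T> l"
  shows "2 * b * card {j \<in> {1..n}. v j \<in> A \<and> fsc_layer b \<T> \<eta> v j = l}
    \<le> 2 * card {j \<in> {1..n}. v j \<in> A} + card (subtiles_of b \<T> A) * (b - 1)"
proof -
  let ?F = "subtiles_of b \<T> A"
  let ?w = "\<lambda>e. (e - 1 + (b - l)) mod b"
  note fin = subtiles_of_finite_card(1)[OF l A]
  \<comment> \<open>The subtiles inside \<open>A\<close> partition the points of \<open>A\<close>.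
    The predicate \<open>P\<close> is free because both the vertices of layer \<open>l\<close> and
    all vertices in \<open>A\<close> are counted this way.\<close>
  have split: "card {j \<in> {1..n}. v j \<in> A \<and> P j} = (\<Sum>S\<in>?F. card {j \<in> {1..n}. v j \<in> S \<and> P j})"
    for P
  proof -
    have "{j \<in> {1..n}. v j \<in> A \<and> P j} = (\<Union>S\<in>?F. {j \<in> {1..n}. v j \<in> S \<and> P j})"
    proof (intro set_eqI iffI)
      fix j assume "j \<in> {j \<in> {1..n}. v j \<in> A \<and> P j}"
      then show "j \<in> (\<Union>S\<in>?F. {j \<in> {1..n}. v j \<in> S \<and> P j})"
        using subtile_at_in_subtiles_of[OF l A, of "v j"] mem_subtile_at[of "v j"] by auto
    qed (auto simp: subtiles_of_def)
    moreover have "{j \<in> {1..n}. v j \<in> S \<and> P j} \<inter> {j \<in> {1..n}. v j \<in> S' \<and> P j} = {}"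
      if "S \<in> ?F" "S' \<in> ?F" "S \<noteq> S'" for S S'
      using that subtile_at_eq[of S] subtile_at_eq[of S']
      unfolding subtiles_of_def disjoint_iff mem_Collect_eq by metis
    ultimately show ?thesis
      using fin by (simp add: card_UN_disjoint)
  qed
  have "b * card {j \<in> {1..n}. v j \<in> A \<and> fsc_layer b \<T> \<eta> v j = l}
      = (\<Sum>S\<in>?F. b * card {j \<in> {1..n}. v j \<in> S \<and> fsc_layer b \<T> \<eta> v j = l})"
    unfolding split by (rule sum_distrib_left)
  also have "\<dots> \<le> (\<Sum>S\<in>?F. card {j \<in> {1..n}. v j \<in> S} + ?w (\<eta> S))"
    using l by (intro sum_mono card_layer_in_subtile) (auto simp: subtiles_of_def)
  also have "\<dots> = card {j \<in> {1..n}. v j \<in> A} + (\<Sum>S\<in>?F. ?w (\<eta> S))"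
    using split[of "\<lambda>_. True"] by (simp add: sum.distrib)
  finally have le: "b * card {j \<in> {1..n}. v j \<in> A \<and> fsc_layer b \<T> \<eta> v j = l}
      \<le> card {j \<in> {1..n}. v j \<in> A} + (\<Sum>S\<in>?F. ?w (\<eta> S))" .
  \<comment> \<open>The excess \<open>?w\<close> depends on a subtile only through its shade, so the
    shading replaces the sum over subtiles by one over all shades, which \<open>sum_rotation\<close>
    evaluates. The factor \<open>b\<close> is cancelled afterwards.\<close>
  have "b * (\<Sum>S\<in>?F. ?w (\<eta> S)) = card ?F * (\<Sum>e\<in>{1..b}. ?w e)"
  proof (rule sum_equidistributed[OF fin])
    show "\<eta> S \<in> {1..b}" if "S \<in> ?F" for S
      using shading that unfolding shading_def subtiles_of_def by blast
    show "card {S \<in> ?F. \<eta> S = i} = card {S \<in> ?F. \<eta> S = j}" if "i \<in> {1..b}" "j \<in> {1..b}" for i j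
      using shading that l A unfolding shading_def by blast
  qed
  then have "b * (2 * (\<Sum>S\<in>?F. ?w (\<eta> S))) = card ?F * (2 * (\<Sum>e\<in>{1..b}. ?w e))"
    by simp
  also have "\<dots> = b * (card ?F * (b - 1))"
    using sum_rotation[OF b_pos, of "b - l"] by (simp only: mult_ac)
  finally have "2 * (\<Sum>S\<in>?F. ?w (\<eta> S)) = card ?F * (b - 1)"
    using b_pos by simp
  then show ?thesis
    using le by linarith
qed

section \<open>Rounds and properness of the coloring\<close>

lemma fsc_round_less:
  assumes "i \<in> {1..n}" and l: "l = fsc_layer b \<T> \<eta> v i"
  shows "fsc_round b \<T> \<eta> v i
    < card {j \<in> {1..n}. v j \<in> tile_at \<T> l (v i) \<and> fsc_layer b \<T> \<eta> v j = l}"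
proof -
  have "v i \<in> tile_at \<T> l (v i)"
    using tile_at(2) fsc_layer_range l by blast
  \<comment> \<open>Strictness comes from \<open>i\<close> itself: it belongs to the set on the
    right but is not among its own predecessors.\<close>
  then show ?thesis
    unfolding fsc_round_def Let_def l using assms(1) l by (intro psubset_card_mono) auto
qed

text \<open>A color encodes a tile color and a round. If two colors agree, the short distance forces
  the same tile and layer; but then the round of \<open>j\<close> counts \<open>i\<close> and
  everything that the round of \<open>i\<close> counts, so the rounds differ.\<close>

lemma fold_shade_color_neq:
  assumes "i \<ge> 1" "i < j" "dist (v i) (v j) \<le> \<sigma>"
  shows "fold_shade_color b k \<phi> \<T> \<eta> v i \<noteq> fold_shade_color b k \<phi> \<T> \<eta> v j"
proof
  let ?l = "fsc_layer b \<T> \<eta> v" and ?t = "fsc_round b \<T> \<eta> v"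
  assume "fold_shade_color b k \<phi> \<T> \<eta> v i = fold_shade_color b k \<phi> \<T> \<eta> v j"
  \<comment> \<open>Tile colors lie in \<open>{1..k}\<close>; subtracting 1 turns them into
    remainders modulo \<open>k\<close>, so that division by \<open>k\<close> separates them from the
    rounds.\<close>
  then have eq: "(\<phi> (?l i) (v i) - 1) + k * ?t i = (\<phi> (?l j) (v j) - 1) + k * ?t j"
    and ci: "\<phi> (?l i) (v i) \<in> {1..k}" and cj: "\<phi> (?l j) (v j) \<in> {1..k}"
    using color_range[OF fsc_layer_range] unfolding fold_shade_color_def by force+
  have lt: "\<phi> (?l i) (v i) - 1 < k" "\<phi> (?l j) (v j) - 1 < k"
    using ci cj by auto
  have "\<phi> (?l i) (v i) - 1 = \<phi> (?l j) (v j) - 1"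
    using arg_cong[OF eq, of "\<lambda>x. x mod k"] lt by simp
  then have color: "\<phi> (?l i) (v i) = \<phi> (?l j) (v j)"
    using ci cj by auto
  have round: "?t i = ?t j"
    using eq color lt by auto
  have tile: "tile_at \<T> (?l i) (v i) = tile_at \<T> (?l j) (v j)" "?l i = ?l j"
    using same_color_tile_eq[OF fsc_layer_range fsc_layer_range tile_at(1)[OF fsc_layer_range]
      tile_at(1)[OF fsc_layer_range] tile_at(2)[OF fsc_layer_range] tile_at(2)[OF fsc_layer_range]
      color assms(3)] by auto
  have "v i \<in> tile_at \<T> (?l i) (v i)"
    using tile_at(2) fsc_layer_range by blast
  then have "?t i < ?t j"
    unfolding fsc_round_def Let_def using assms(1,2) tile by (intro psubset_card_mono) auto
  then show False
    using round by simp
qed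

end

section \<open>Clique number and the final bound\<close>

lemma card_clique_le_clique_number:
  assumes "finite V" "C \<subseteq> V" "clique C E"
  shows "card C \<le> clique_number V E"
proof -
  have "{card C | C. C \<subseteq> V \<and> clique C E} \<subseteq> card ` Pow V"
    by auto
  then have "finite {card C | C. C \<subseteq> V \<and> clique C E}"
    using assms(1) finite_subset by blast
  then show ?thesis
    unfolding clique_number_def using assms by (intro Max_ge) blast+
qed

theorem mainTheorem10:
  fixes \<sigma> :: real and b k n :: nat
    and \<phi> :: "nat \<Rightarrow> plane \<Rightarrow> nat" and \<T> :: "nat \<Rightarrow> plane set set" and \<eta> :: "plane set \<Rightarrow> nat"
    and D :: "nat \<Rightarrow> plane set" and v :: "nat \<Rightarrow> plane" and \<rho> :: "nat \<Rightarrow> real"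
  assumes "\<sigma> \<ge> 1" and "b \<ge> 1"
    and "fold_coloring \<sigma> b k \<phi>"
    and "solid_tilings \<sigma> b \<phi> \<T>"
    and "shading b \<T> \<eta>"
    and "\<forall>i\<in>{1..n}. D i = cball (v i) (\<rho> i)"
    and "\<forall>i\<in>{1..n}. diameter (D i) \<in> {1..\<sigma>}"
  shows "proper_coloring (disk_graph_edges n D) (fold_shade_color b k \<phi> \<T> \<eta> v) \<and>
    (\<forall>i\<in>{1..n}. int (fold_shade_color b k \<phi> \<T> \<eta> v i) \<le>
       int k * \<lfloor>(real (clique_number {1..n} (disk_graph_edges n D))
                 + (real b - 1) * real (max_subtiles b \<T>) / 2) / real b\<rfloor>)"
proof -
  interpret solid_fold_coloring \<sigma> b k \<phi> \<T>
    using assms by unfold_locales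
  let ?E = "disk_graph_edges n D" and ?c = "fold_shade_color b k \<phi> \<T> \<eta> v"
  \<comment> \<open>A negative radius would make the ball empty, with diameter 0 by convention, and
    this is excluded by the lower bound 1.\<close>
  have radius: "1 \<le> 2 * \<rho> i" "2 * \<rho> i \<le> \<sigma>" if "i \<in> {1..n}" for i
  proof -
    have "diameter (cball (v i) (\<rho> i)) \<in> {1..\<sigma>}"
      using assms(6,7) that by metis
    then show "1 \<le> 2 * \<rho> i" "2 * \<rho> i \<le> \<sigma>"
      by (auto split: if_splits)
  qed
  have "proper_coloring ?E ?c"
    unfolding proper_coloring_def
  proof (intro allI impI)
    fix u w assume "{u, w} \<in> ?E"
    then have uw: "u \<in> {1..n}" "w \<in> {1..n}" "u \<noteq> w" "D u \<inter> D w \<noteq> {}"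
      unfolding disk_graph_edges_def by (auto simp: doubleton_eq_iff)
    then obtain p where "dist (v u) p \<le> \<rho> u" "dist (v w) p \<le> \<rho> w"
      using assms(6) by auto
    then have "dist (v u) (v w) \<le> \<sigma>"
      using dist_triangle2[of "v u" "v w" p] radius(2)[OF uw(1)] radius(2)[OF uw(2)] by linarith
    then show "?c u \<noteq> ?c w"
      using fold_shade_color_neq[of u w v \<eta>] fold_shade_color_neq[of w u v \<eta>] uw
      by (cases u w rule: linorder_cases) (auto simp: dist_commute)
  qed
  moreover have "int (?c i) \<le> int k * \<lfloor>(real (clique_number {1..n} ?E)
      + (real b - 1) * real (max_subtiles b \<T>) / 2) / real b\<rfloor>" if i: "i \<in> {1..n}" for i
  proof -
    define l where "l = fsc_layer b \<T> \<eta> v i"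
    define A where "A = tile_at \<T> l (v i)"
    let ?\<omega> = "clique_number {1..n} ?E" and ?\<gamma> = "max_subtiles b \<T>"
    let ?N = "card {j \<in> {1..n}. v j \<in> A}" and ?t = "fsc_round b \<T> \<eta> v i"
    have l: "l \<in> {1..b}"
      unfolding l_def by (rule fsc_layer_range)
    have A: "A \<in> \<T> l"
      unfolding A_def using tile_at l by blast
    have "clique {j \<in> {1..n}. v j \<in> A} ?E"
      unfolding clique_def
    proof (intro ballI impI)
      fix x y assume xy: "x \<in> {j \<in> {1..n}. v j \<in> A}" "y \<in> {j \<in> {1..n}. v j \<in> A}" "x \<noteq> y"
      then have "dist (v x) (v y) < 1"
        using tile_dist_less[OF l A] by blast
      \<comment> \<open>The midpoint is at distance less than 1/2 from both centers, and each radius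
        is at least 1/2.\<close>
      then have "midpoint (v x) (v y) \<in> cball (v x) (\<rho> x) \<inter> cball (v y) (\<rho> y)"
        using radius(1)[of x] radius(1)[of y] xy by (auto simp: dist_midpoint)
      then have "D x \<inter> D y \<noteq> {}"
        using assms(6) xy by auto
      then show "{x, y} \<in> ?E"
        unfolding disk_graph_edges_def using xy by blast
    qed
    then have N: "?N \<le> ?\<omega>"
      by (intro card_clique_le_clique_number) auto
    \<comment> \<open>Rounds start at 0 and tile colors reach \<open>k\<close>, so the color is at
      most \<open>k * (?t + 1)\<close>. It is thus \<open>?t + 1\<close> that has to be bounded, and
      as an integer it also stays below the floor.\<close>
    have "2 * b * (?t + 1) \<le> 2 * b * card {j \<in> {1..n}. v j \<in> A \<and> fsc_layer b \<T> \<eta> v j = l}"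
      using fsc_round_less[OF i l_def] unfolding A_def by (intro mult_le_mono2) simp
    also have "\<dots> \<le> 2 * ?N + card (subtiles_of b \<T> A) * (b - 1)"
      by (rule card_layer_in_tile[OF assms(5) l A])
    also have "\<dots> \<le> 2 * ?\<omega> + ?\<gamma> * (b - 1)"
      using N card_subtiles_of_le_max[OF l A] by (intro add_mono mult_le_mono) auto
    finally have "real (2 * b * (?t + 1)) \<le> real (2 * ?\<omega> + ?\<gamma> * (b - 1))"
      by (rule of_nat_mono)
    then have "real (?t + 1) \<le> (real ?\<omega> + (real b - 1) * real ?\<gamma> / 2) / real b"
      using assms(2) by (simp add: field_simps of_nat_diff)
    then have "int (?t + 1) \<le> \<lfloor>(real ?\<omega> + (real b - 1) * real ?\<gamma> / 2) / real b\<rfloor>"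
      by (simp add: le_floor_iff)
    then have "int k * int (?t + 1) \<le> int k * \<lfloor>(real ?\<omega> + (real b - 1) * real ?\<gamma> / 2) / real b\<rfloor>"
      by (intro mult_left_mono) auto
    moreover have "?c i \<le> k * (?t + 1)"
      using color_range[OF l, of "v i"] unfolding fold_shade_color_def l_def by simp
    then have "int (?c i) \<le> int k * int (?t + 1)"
      by (metis of_nat_le_iff of_nat_mult)
    ultimately show ?thesis
      by linarith
  qed
  ultimately show ?thesis
    by blast
qed

end
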